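(* Let $V$ be a reflexive Banach space and a vector lattice such that $V_+$ is closed, and let $\{m_\rho\}_{\rho>0}$ be a family of penalty maps as in the context. Assume that (a) there exists $v_0\in V$ such that $v_0\le\Phi(v)$ for all $v\in V$; (b) either $m_\rho(\mathrm{I}-\Phi)\colon V\to V^*$ is completely continuous (for each $\rho$), or $m_\rho(\mathrm{I}-\Phi)\colon V\to V^*$ is monotone, radially continuous and bounded (for each $\rho$); (c) $\Phi\colon V\to V$ is completely continuous. Let $f_\rho\to f$ in $V^*$ as $\rho\to0$. Then there exist a subsequence $\rho_n\to0$ and elements $y_{\rho_n}\in V$ solving $$Ay_{\rho_n}+\tfrac1{\rho_n}m_{\rho_n}\big(y_{\rho_n}-\Phi(y_{\rho_n})\big)=f_{\rho_n}\quad\text{in }V^*$$ such that $y_{\rho_n}\to y$ (strongly) in $V$, where $y$ solves $$y\le\Phi(y),\qquad\langle Ay-f,\,y-v\rangle\le0\quad\forall v\in V:\ v\le\Phi(y).$$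
   Context: $V$ is real with dual $V^*$ and duality pairing $\langle\cdot,\cdot\rangle$; it is a vector lattice for a partial order $\le$ ($u\le v$ implies $u+w\le v+w$ and $\lambda u\le\lambda v$ for $w\in V,\lambda\ge0$; $\inf(u,v),\sup(u,v)$ exist in $V$); $V_+:=\{v\in V:v\ge0\}$. With $u^+:=\sup(0,u)$, $u^-:=u^+-u$, $A\colon V\to V^*$ is linear and there are $C_a,C_b>0$ with $\langle Au,v\rangle\le C_b\|u\|_V\|v\|_V$, $\langle Au,u\rangle\ge C_a\|u\|_V^2$, $\langle Au^+,u^-\rangle\le0$ for all $u,v\in V$. $\Phi\colon V\to V$ is a given map. Penalty maps: for each $\rho>0$, $m_\rho\colon V\to V^*$ is hemicontinuous ($s\mapsto\langle m_\rho(x+sy),z\rangle$ is continuous for all $x,y,z\in V$) and: (i) $m_\rho(v)=0$ if $v\le0$; (ii) $\langle m_\rho(u)-m_\rho(v),u-v\rangle\ge0$ for all $u,v\in V$; (iii) if $z_\rho\rightharpoonup z$ in $V$ and $m_\rho(z_\rho)\to0$ in $V^*$ as $\rho\to0$, then $z\le0$. $m_\rho(\mathrm{I}-\Phi)$ denotes $v\mapsto m_\rho(v-\Phi(v))$. A map $T\colon V\to V^*$ is radially continuous if $s\mapsto\langle T(x+sy),y\rangle$ is continuous for all $x,y\in V$; it is bounded if it maps bounded sets to bounded sets. A map $R\colon X\to Y$ between Banach spaces is completely continuous if $x_n\rightharpoonup x$ in $X$ implies $R(x_n)\to R(x)$ in $Y$. *)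

theory Defs
  imports "HOL-Analysis.Analysis"
begin

text \<open>
  Throughout, the dual space is the type \<open>'a \<Rightarrow>\<^sub>L real\<close> of bounded linear functionals with the
  operator norm, and the duality pairing of \<open>\<phi>\<close> and \<open>v\<close> is \<open>blinfun_apply \<phi> v\<close>.  A vector lattice
  is a type in \<open>ordered_real_vector\<close> and \<open>lattice\<close>.
\<close>

definition bidual_embedding :: "'a::real_normed_vector \<Rightarrow> (('a \<Rightarrow>\<^sub>L real) \<Rightarrow>\<^sub>L real)"
  where "bidual_embedding x = Blinfun (\<lambda>\<phi>. blinfun_apply \<phi> x)"

lemma bidual_embedding_apply [simp]:
  "blinfun_apply (bidual_embedding x) \<phi> = blinfun_apply \<phi> x"
  unfolding bidual_embedding_def
  by (simp add: bounded_linear_Blinfun_apply blinfun.bounded_linear_left)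

definition reflexive_space :: "'a::real_normed_vector itself \<Rightarrow> bool"
  where "reflexive_space _ \<longleftrightarrow>
    surj (bidual_embedding :: 'a \<Rightarrow> (('a \<Rightarrow>\<^sub>L real) \<Rightarrow>\<^sub>L real))"

definition weakly_converges :: "(nat \<Rightarrow> 'a::real_normed_vector) \<Rightarrow> 'a \<Rightarrow> bool"
  where "weakly_converges x l \<longleftrightarrow>
    (\<forall>\<phi> :: 'a \<Rightarrow>\<^sub>L real. (\<lambda>n. blinfun_apply \<phi> (x n)) \<longlonglongrightarrow> blinfun_apply \<phi> l)"

definition completely_continuous :: "('a::banach \<Rightarrow> 'b::banach) \<Rightarrow> bool"
  where "completely_continuous R \<longleftrightarrow>
    (\<forall>x l. weakly_converges x l \<longrightarrow> (\<lambda>n. R (x n)) \<longlonglongrightarrow> R l)"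

definition hemicontinuous :: "('a::real_normed_vector \<Rightarrow> 'a \<Rightarrow>\<^sub>L real) \<Rightarrow> bool"
  where "hemicontinuous T \<longleftrightarrow>
    (\<forall>x y z. continuous_on UNIV (\<lambda>s::real. blinfun_apply (T (x + s *\<^sub>R y)) z))"

definition radially_continuous :: "('a::real_normed_vector \<Rightarrow> 'a \<Rightarrow>\<^sub>L real) \<Rightarrow> bool"
  where "radially_continuous T \<longleftrightarrow>
    (\<forall>x y. continuous_on UNIV (\<lambda>s::real. blinfun_apply (T (x + s *\<^sub>R y)) y))"

definition monotone_operator :: "('a::real_normed_vector \<Rightarrow> 'a \<Rightarrow>\<^sub>L real) \<Rightarrow> bool"
  where "monotone_operator T \<longleftrightarrow>
    (\<forall>u v. blinfun_apply (T u - T v) (u - v) \<ge> 0)"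

definition bounded_operator :: "('a::real_normed_vector \<Rightarrow> 'b::real_normed_vector) \<Rightarrow> bool"
  where "bounded_operator T \<longleftrightarrow> (\<forall>S. bounded S \<longrightarrow> bounded (T ` S))"

definition pos_part :: "'a::{ordered_real_vector, lattice} \<Rightarrow> 'a"
  where "pos_part u = sup 0 u"

definition neg_part :: "'a::{ordered_real_vector, lattice} \<Rightarrow> 'a"
  where "neg_part u = pos_part u - u"

definition admissible_operator ::
    "('a::{banach, ordered_real_vector, lattice} \<Rightarrow> 'a \<Rightarrow>\<^sub>L real) \<Rightarrow> bool"
  where "admissible_operator A \<longleftrightarrow>
    linear A \<and>
    (\<exists>C\<^sub>b>0. \<forall>u v. blinfun_apply (A u) v \<le> C\<^sub>b * norm u * norm v) \<and>
    (\<exists>C\<^sub>a>0. \<forall>u. blinfun_apply (A u) u \<ge> C\<^sub>a * (norm u)\<^sup>2) \<and>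
    (\<forall>u. blinfun_apply (A (pos_part u)) (neg_part u) \<le> 0)"

text \<open>
  The parameter of a family indexed by \<open>\<rho> > 0\<close> is an arbitrary real; nothing is required at
  \<open>\<rho> \<le> 0\<close>.  In the last clause, convergence as \<open>\<rho> \<rightarrow> 0\<close> is along an arbitrary null sequence of
  positive parameters.  Requiring it only for families converging along the whole filter
  \<open>at_right 0\<close> would be too weak to force feasibility of limits: on \<open>\<real>\<^sup>2\<close> one could penalise only
  the first component along one null sequence of parameters and only the second one otherwise.
\<close>

definition penalty_maps ::
    "(real \<Rightarrow> 'a::{banach, ordered_real_vector, lattice} \<Rightarrow> 'a \<Rightarrow>\<^sub>L real) \<Rightarrow> bool"
  where "penalty_maps m \<longleftrightarrow>
    (\<forall>\<rho>>0. hemicontinuous (m \<rho>) \<and> (\<forall>v\<le>0. m \<rho> v = 0) \<and> monotone_operator (m \<rho>)) \<and>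
    (\<forall>r z l. (\<forall>n. r n > 0) \<longrightarrow> r \<longlonglongrightarrow> 0 \<longrightarrow> weakly_converges z l \<longrightarrow>
       (\<lambda>n. m (r n) (z n)) \<longlonglongrightarrow> 0 \<longrightarrow> l \<le> 0)"

end

theory Submission
  imports Defs
begin

text \<open>
  Testing the penalised equation with \<open>y - v\<^sub>0\<close> makes the penalty term nonnegative, because
  \<open>\<langle>m\<^sub>\<rho>(u), u + w\<rangle> \<ge> 0\<close> for every \<open>w \<ge> 0\<close>; coercivity then bounds all solutions uniformly in \<open>\<rho>\<close>.
  Solutions exist by Schauder's theorem applied to \<open>A\<^sup>-\<^sup>1(f - M \<cdot>)\<close> in the completely continuous case
  and by the Browder--Minty theorem in the monotone case.  A weak limit \<open>y\<^sub>0\<close> of solutions satisfies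
  the constraint by the third property of the penalty maps.  Testing with \<open>v + \<Phi>(y\<^sub>n) - \<Phi>(y\<^sub>0)\<close>, which
  is feasible for the obstacle \<open>\<Phi>(y\<^sub>n)\<close> and converges strongly to \<open>v\<close>, gives strong convergence
  (with \<open>v = y\<^sub>0\<close>) and the variational inequality.

  Reflexivity enters only through weak cluster points of bounded nets, obtained from Tychonoff's
  theorem.  That bounded sequences have weakly convergent subsequences uses the coercive form as a
  substitute for separability arguments.
\<close>

section \<open>Fixed points\<close>

text \<open>Tychonoff's theorem, transferred from \<open>product_topology\<close> to the topology of
  the function type. With countable index type it also yields sequential compactness, i.e. diagonal
  subsequences.\<close>

lemma compact_product:
  fixes K :: "'i \<Rightarrow> 'b::topological_space set"
  assumes "\<And>i. compact (K i)"
  shows "compact {f. \<forall>i. f i \<in> K i}"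
proof -
  have "compactin (product_topology (\<lambda>i. euclidean) (UNIV::'i set)) (PiE UNIV K)"
    using assms by (simp add: compactin_PiE)
  moreover have "PiE UNIV K = {f. \<forall>i. f i \<in> K i}"
    by (auto simp: PiE_iff)
  ultimately show ?thesis
    by (simp add: euclidean_product_topology)
qed

lemma tendsto_fun_iff:
  fixes f :: "'j \<Rightarrow> 'i \<Rightarrow> 'b::topological_space"
  shows "(f \<longlongrightarrow> l) F \<longleftrightarrow> (\<forall>i. ((\<lambda>n. f n i) \<longlongrightarrow> l i) F)"
  using limitin_componentwise[of "\<lambda>_. euclidean" UNIV f l F]
  by (simp add: euclidean_product_topology)

text \<open>
  The library states Brouwer's theorem for Euclidean types, whose dimension cannot vary inside a
  proof; Kuhn's lemma is available for every natural number \<open>n\<close>.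
\<close>

lemma brouwer_unit_cube:
  fixes f :: "(nat \<Rightarrow> real) \<Rightarrow> nat \<Rightarrow> real"
  assumes cont: "\<And>i. i < n \<Longrightarrow> continuous_on UNIV (\<lambda>x. f x i)"
    and range: "\<And>x i. i < n \<Longrightarrow> f x i \<in> {0..1}"
  shows "\<exists>x. (\<forall>i. x i \<in> {0..1}) \<and> (\<forall>i<n. f x i = x i)"
proof -
  define sc where "sc p q = (\<lambda>i. if i < n then real (q i) / real p else 0)" for p and q :: "nat \<Rightarrow> nat"
  \<comment> \<open>Label 0 means that \<open>f\<close> does not decrease coordinate
    \<open>i\<close> at the grid point. The top face is forced to label 1, as Kuhn's lemma demands;
    on the bottom face label 0 follows from \<open>f x i \<ge> 0\<close>.\<close>
  define lab where "lab p q i = (if q i \<noteq> p \<and> sc p q i \<le> f (sc p q) i then 0 else 1::nat)" for p q i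
  define near where "near q r \<longleftrightarrow> (\<forall>j<n. q j \<le> r j \<and> r j \<le> q j + 1)" for q r :: "nat \<Rightarrow> nat"
  have "\<exists>q. (\<forall>i<n. q i < Suc p) \<and>
    (\<forall>i<n. \<exists>r s. near q r \<and> near q s \<and> lab (Suc p) r i = 0 \<and> lab (Suc p) s i = 1)" for p
  proof -
    obtain q where q: "\<forall>i<n. q i < Suc p"
      "\<forall>i<n. \<exists>r s. (\<forall>j<n. q j \<le> r j \<and> r j \<le> q j + 1) \<and> (\<forall>j<n. q j \<le> s j \<and> s j \<le> q j + 1) \<and>
         lab (Suc p) r i \<noteq> lab (Suc p) s i"
    proof (rule kuhn_lemma[of "Suc p" n "lab (Suc p)"])
      show "\<forall>x. (\<forall>i<n. x i \<le> Suc p) \<longrightarrow> (\<forall>i<n. x i = 0 \<longrightarrow> lab (Suc p) x i = 0)"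
        using range by (auto simp: lab_def sc_def)
    qed (auto simp: lab_def)
    have "\<exists>r s. near q r \<and> near q s \<and> lab (Suc p) r i = 0 \<and> lab (Suc p) s i = 1" if "i < n" for i
    proof -
      have "\<exists>r s. near q r \<and> near q s \<and> lab (Suc p) r i \<noteq> lab (Suc p) s i"
        using q(2) that by (simp add: near_def)
      then obtain r s where rs: "near q r" "near q s" "lab (Suc p) r i \<noteq> lab (Suc p) s i"
        by blast
      have "lab (Suc p) r i \<in> {0,1}" "lab (Suc p) s i \<in> {0,1}"
        by (auto simp: lab_def)
      then show ?thesis using rs by auto
    qed
    then show ?thesis using q(1) by blast
  qed
  then have "\<exists>q. \<forall>p. (\<forall>i<n. q p i < Suc p) \<and>
    (\<forall>i<n. \<exists>r s. near (q p) r \<and> near (q p) s \<and> lab (Suc p) r i = 0 \<and> lab (Suc p) s i = 1)"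
    by (intro choice allI)
  then obtain q where q: "\<And>p i. i < n \<Longrightarrow> q p i < Suc p"
    and rs: "\<And>p i. i < n \<Longrightarrow>
      \<exists>r s. near (q p) r \<and> near (q p) s \<and> lab (Suc p) r i = 0 \<and> lab (Suc p) s i = 1"
    by blast
  define Q where "Q p = sc (Suc p) (q p)" for p
  have Q01: "Q p i \<in> {0..1}" for p i
  proof (cases "i < n")
    case True
    then have "real (q p i) \<le> real (Suc p)" using q[of i p] by simp
    then show ?thesis using True by (simp add: Q_def sc_def del: of_nat_Suc)
  qed (simp add: Q_def sc_def)
  have "seq_compact {f :: nat \<Rightarrow> real. \<forall>i. f i \<in> {0..1}}"
    by (intro compact_imp_seq_compact compact_product) auto
  then obtain x h where x: "\<forall>i. x i \<in> {0..1}" and h: "strict_mono h" and lim: "(Q \<circ> h) \<longlonglongrightarrow> x"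
    by (rule seq_compactE[where f = Q]) (use Q01 in auto)
  have inv0: "(\<lambda>k. 1 / real (Suc (h k))) \<longlonglongrightarrow> 0"
    using LIMSEQ_subseq_LIMSEQ[OF LIMSEQ_inverse_real_of_nat h] by (simp add: o_def inverse_eq_divide)
  \<comment> \<open>The cells of the grid have side \<open>1 / Suc p\<close>, so any choice of
    vertices in the cells along \<open>h\<close> has the same limit \<open>x\<close>.\<close>
  have near_lim: "(\<lambda>k. f (sc (Suc (h k)) (u k)) i) \<longlonglongrightarrow> f x i"
    "(\<lambda>k. sc (Suc (h k)) (u k) i) \<longlonglongrightarrow> x i"
    if u: "\<And>k. near (q (h k)) (u k)" and "i < n" for u i
  proof -
    have "(\<lambda>k. sc (Suc (h k)) (u k)) \<longlonglongrightarrow> x"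
      unfolding tendsto_fun_iff
    proof
      fix j
      have Qlim: "(\<lambda>k. Q (h k) j) \<longlonglongrightarrow> x j"
        using lim by (simp add: tendsto_fun_iff)
      have bounds: "Q (h k) j \<le> sc (Suc (h k)) (u k) j"
          "sc (Suc (h k)) (u k) j \<le> Q (h k) j + 1 / real (Suc (h k))" for k
      proof -
        have "j < n \<Longrightarrow> real (q (h k) j) \<le> real (u k j) \<and> real (u k j) \<le> real (q (h k) j) + 1"
          using u[of k] by (force simp: near_def)
        then show "Q (h k) j \<le> sc (Suc (h k)) (u k) j"
          "sc (Suc (h k)) (u k) j \<le> Q (h k) j + 1 / real (Suc (h k))"
          by (auto simp: Q_def sc_def divide_right_mono simp del: of_nat_Suc simp flip: add_divide_distrib)
      qed
      have "(\<lambda>k. Q (h k) j + 1 / real (Suc (h k))) \<longlonglongrightarrow> x j"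
        using tendsto_add[OF Qlim inv0] by simp
      with Qlim show "(\<lambda>k. sc (Suc (h k)) (u k) j) \<longlonglongrightarrow> x j"
        by (rule real_tendsto_sandwich[rotated 2]) (intro always_eventually allI bounds)+
    qed
    moreover have "isCont (\<lambda>x. f x i) x"
      using cont[OF \<open>i < n\<close>] by (simp add: continuous_on_eq_continuous_at)
    ultimately show "(\<lambda>k. f (sc (Suc (h k)) (u k)) i) \<longlonglongrightarrow> f x i"
      "(\<lambda>k. sc (Suc (h k)) (u k) i) \<longlonglongrightarrow> x i"
      by (fact isCont_tendsto_compose[rotated], simp add: tendsto_fun_iff)
  qed
  \<comment> \<open>The vertices with label 0 give \<open>x i \<le> f x i\<close> in the limit,
    those with label 1 the reverse inequality.\<close>
  have "f x i = x i" if i: "i < n" for i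
  proof (rule antisym)
    obtain r s where r: "\<And>p. near (q p) (r p)" "\<And>p. lab (Suc p) (r p) i = 0"
      and s: "\<And>p. near (q p) (s p)" "\<And>p. lab (Suc p) (s p) i = 1"
      using rs[OF i] by metis
    have "sc (Suc p) (r p) i \<le> f (sc (Suc p) (r p)) i" for p
      using r(2)[of p] by (simp add: lab_def split: if_splits)
    then show "x i \<le> f x i"
      using near_lim[of "\<lambda>k. r (h k)" i] r(1) i
      by (intro LIMSEQ_le[of "\<lambda>k. sc (Suc (h k)) (r (h k)) i" _ "\<lambda>k. f (sc (Suc (h k)) (r (h k))) i"]) auto
    have "f (sc (Suc p) (s p)) i \<le> sc (Suc p) (s p) i" for p
    proof (cases "s p i = Suc p")
      case True
      then have "sc (Suc p) (s p) i = 1" using i by (simp add: sc_def)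
      then show ?thesis using range[OF i] by auto
    next
      case False
      then show ?thesis using s(2)[of p] by (simp add: lab_def split: if_splits)
    qed
    then show "f x i \<le> x i"
      using near_lim[of "\<lambda>k. s (h k)" i] s(1) i
      by (intro LIMSEQ_le[of "\<lambda>k. f (sc (Suc (h k)) (s (h k))) i" _ "\<lambda>k. sc (Suc (h k)) (s (h k)) i"]) auto
  qed
  with x show ?thesis by blast
qed

section \<open>Barycentric fixed points and Schauder's theorem\<close>

text \<open>Sending coefficients \<open>t\<close> to the normalised weights at the point
  \<open>Y t\<close> is a continuous map of a cube into itself; at a fixed point, \<open>Y t\<close>
  is the barycentre of the \<open>v i\<close> for its own weights. This is the common
  finite-dimensional core of Schauder's theorem and of the monotone case.\<close>

lemma weighted_fixed_point:
  fixes v :: "'i \<Rightarrow> 'a::real_normed_vector" and \<alpha> :: "'i \<Rightarrow> 'a \<Rightarrow> real"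
  assumes "finite I"
    and cont: "\<And>i. i \<in> I \<Longrightarrow> continuous_on UNIV (\<alpha> i)"
    and nonneg: "\<And>i y. i \<in> I \<Longrightarrow> 0 \<le> \<alpha> i y"
    and pos: "\<And>y. 0 < (\<Sum>i\<in>I. \<alpha> i y)"
  shows "\<exists>y. (\<Sum>i\<in>I. \<alpha> i y) *\<^sub>R y = (\<Sum>i\<in>I. \<alpha> i y *\<^sub>R v i)"
proof -
  obtain e where e: "bij_betw e {..<card I} I"
    using ex_bij_betw_nat_finite[OF \<open>finite I\<close>] by (auto simp: atLeast0LessThan)
  have reindex: "(\<Sum>k<card I. g (e k)) = (\<Sum>i\<in>I. g i)" for g :: "'i \<Rightarrow> 'c::comm_monoid_add"
    using sum.reindex_bij_betw[OF e] by simp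
  have eI: "e k \<in> I" if "k < card I" for k
    using e that by (auto simp: bij_betw_def)
  define Y where "Y t = (\<Sum>k<card I. t k *\<^sub>R v (e k))" for t
  define S where "S y = (\<Sum>i\<in>I. \<alpha> i y)" for y
  have S: "S y > 0" for y using pos by (simp add: S_def)
  have "\<exists>t. (\<forall>k. t k \<in> {0..1}) \<and> (\<forall>k<card I. \<alpha> (e k) (Y t) / S (Y t) = t k)"
  proof (rule brouwer_unit_cube)
    fix k assume k: "k < card I"
    have Y: "continuous_on UNIV Y"
      unfolding Y_def by (intro continuous_intros continuous_on_product_then_coordinatewise continuous_on_id)
    have \<alpha>: "continuous_on UNIV (\<lambda>t. \<alpha> i (Y t))" if "i \<in> I" for i
      using cont[OF that] Y by (rule continuous_on_compose2) auto
    show "continuous_on UNIV (\<lambda>t. \<alpha> (e k) (Y t) / S (Y t))"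
      using S unfolding S_def by (intro continuous_intros \<alpha> eI k) (auto simp: less_imp_neq[symmetric])
    show "\<alpha> (e k) (Y t) / S (Y t) \<in> {0..1}" for t
      using S[of "Y t"] nonneg[OF eI[OF k], of "Y t"] member_le_sum[OF eI[OF k], of "\<lambda>i. \<alpha> i (Y t)"]
        nonneg \<open>finite I\<close> by (auto simp: S_def divide_simps)
  qed
  then obtain t where t: "\<And>k. k < card I \<Longrightarrow> t k = \<alpha> (e k) (Y t) / S (Y t)"
    by metis
  have "S (Y t) *\<^sub>R Y t = (\<Sum>k<card I. (S (Y t) * t k) *\<^sub>R v (e k))"
    by (simp add: Y_def scaleR_sum_right)
  also have "\<dots> = (\<Sum>k<card I. \<alpha> (e k) (Y t) *\<^sub>R v (e k))"
    using t S[of "Y t"] by (intro sum.cong) auto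
  also have "\<dots> = (\<Sum>i\<in>I. \<alpha> i (Y t) *\<^sub>R v i)"
    by (rule reindex)
  finally show ?thesis unfolding S_def by blast
qed

text \<open>
  Schauder's projection onto an \<open>\<epsilon>\<close>-net of \<open>K\<close> gives approximate fixed points.
\<close>

theorem schauder:
  fixes g :: "'a::real_normed_vector \<Rightarrow> 'a"
  assumes cont: "continuous_on UNIV g" and "compact K" and range: "\<And>x. g x \<in> K"
  shows "\<exists>x. g x = x"
proof -
  have approx: "\<exists>y. dist (g y) y \<le> \<epsilon>" if "\<epsilon> > 0" for \<epsilon> :: real
  proof -
    have "K \<subseteq> (\<Union>x\<in>K. ball x \<epsilon>)" using that by auto
    then obtain I where I: "I \<subseteq> K" "finite I" "K \<subseteq> (\<Union>x\<in>I. ball x \<epsilon>)"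
      using compactE_image[OF \<open>compact K\<close>, of K "\<lambda>x. ball x \<epsilon>"] by auto
    \<comment> \<open>Only net points closer than \<open>\<epsilon>\<close> to \<open>g y\<close>
      get positive weight, so their barycentre is within \<open>\<epsilon>\<close> of
      \<open>g y\<close>.\<close>
    define \<alpha> where "\<alpha> i y = max 0 (\<epsilon> - dist i (g y))" for i y
    have \<alpha>: "0 \<le> \<alpha> i y" for i y by (simp add: \<alpha>_def)
    have pos: "0 < (\<Sum>i\<in>I. \<alpha> i y)" for y
    proof -
      obtain i where "i \<in> I" "dist i (g y) < \<epsilon>" using I(3) range[of y] by auto
      then show ?thesis using I(2) by (intro sum_pos2[of _ i]) (auto simp: \<alpha>_def)
    qed
    have "\<exists>y. (\<Sum>i\<in>I. \<alpha> i y) *\<^sub>R y = (\<Sum>i\<in>I. \<alpha> i y *\<^sub>R i)"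
      using I(2) \<alpha> pos unfolding \<alpha>_def by (intro weighted_fixed_point continuous_intros cont) auto
    then obtain y where y: "(\<Sum>i\<in>I. \<alpha> i y) *\<^sub>R y = (\<Sum>i\<in>I. \<alpha> i y *\<^sub>R i)" ..
    have "(\<Sum>i\<in>I. \<alpha> i y) * dist (g y) y = norm ((\<Sum>i\<in>I. \<alpha> i y) *\<^sub>R (g y - y))"
      using pos[of y] by (simp add: dist_norm)
    also have "(\<Sum>i\<in>I. \<alpha> i y) *\<^sub>R (g y - y) = (\<Sum>i\<in>I. \<alpha> i y *\<^sub>R (g y - i))"
      by (simp add: scaleR_diff_right sum_subtractf flip: y) (simp add: scaleR_sum_left)
    also have "norm \<dots> \<le> (\<Sum>i\<in>I. \<alpha> i y * \<epsilon>)"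
    proof (rule sum_norm_le)
      fix i
      show "norm (\<alpha> i y *\<^sub>R (g y - i)) \<le> \<alpha> i y * \<epsilon>"
        by (cases "dist i (g y) < \<epsilon>")
          (auto simp: \<alpha>_def dist_norm norm_minus_commute max_def intro!: mult_left_mono)
    qed
    also have "\<dots> = (\<Sum>i\<in>I. \<alpha> i y) * \<epsilon>" by (simp add: sum_distrib_right)
    finally show ?thesis using pos[of y] by auto
  qed
  have "\<exists>y. dist (g y) y \<le> 1 / Suc n" for n by (rule approx) simp
  then obtain y where y: "\<And>n. dist (g (y n)) (y n) \<le> 1 / Suc n" by metis
  obtain z h where h: "strict_mono h" and "((\<lambda>n. g (y n)) \<circ> h) \<longlonglongrightarrow> z"
    using \<open>compact K\<close> range unfolding compact_eq_seq_compact_metric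
    by (elim seq_compactE[where f = "\<lambda>n. g (y n)"]) auto
  then have z: "(\<lambda>n. g (y (h n))) \<longlonglongrightarrow> z" by (simp add: o_def)
  have "(\<lambda>n. 1 / real (Suc (h n))) \<longlonglongrightarrow> 0"
    using LIMSEQ_subseq_LIMSEQ[OF LIMSEQ_inverse_real_of_nat h] by (simp add: o_def inverse_eq_divide)
  then have "(\<lambda>n. g (y (h n)) - y (h n)) \<longlonglongrightarrow> 0"
    by (rule Lim_null_comparison[rotated]) (use y in \<open>auto simp: dist_norm simp del: of_nat_Suc\<close>)
  \<comment> \<open>Approximate fixed points follow their images, so compactness of \<open>K\<close>
    carries over to them.\<close>
  from tendsto_diff[OF z this] have yz: "(\<lambda>n. y (h n)) \<longlonglongrightarrow> z" by simp
  have "(\<lambda>n. g (y (h n))) \<longlonglongrightarrow> g z"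
    using cont yz by (intro isCont_tendsto_compose[of _ g]) (simp_all add: continuous_on_eq_continuous_at)
  with z have "g z = z" by (simp add: LIMSEQ_unique)
  then show ?thesis ..
qed

section \<open>Weak cluster points and monotone operators\<close>

lemma abs_blinfun_le:
  fixes \<phi> :: "'a::real_normed_vector \<Rightarrow>\<^sub>L real"
  assumes "norm x \<le> R"
  shows "\<bar>\<phi> x\<bar> \<le> norm \<phi> * R"
  using order_trans[OF norm_blinfun[of \<phi> x] mult_left_mono[OF assms]] by simp

text \<open>Banach-Alaoglu in the bidual: the evaluations at \<open>x i\<close> lie in a compact
  product of intervals, a cluster point there inherits linearity and the bound \<open>R\<close>, and
  reflexivity represents it by some \<open>z\<close>. The finer filter \<open>G\<close> plays the
  role of a subnet.\<close>

lemma weak_cluster_point: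
  fixes x :: "'i \<Rightarrow> 'a::real_normed_vector"
  assumes refl: "reflexive_space TYPE('a)" and "F \<noteq> bot" and bd: "\<And>i. norm (x i) \<le> R"
  shows "\<exists>z G. G \<noteq> bot \<and> G \<le> F \<and> (\<forall>\<phi>::'a \<Rightarrow>\<^sub>L real. ((\<lambda>i. \<phi> (x i)) \<longlongrightarrow> \<phi> z) G)"
proof -
  define h :: "'i \<Rightarrow> ('a \<Rightarrow>\<^sub>L real) \<Rightarrow> real" where "h i = (\<lambda>\<phi>. \<phi> (x i))" for i
  define K :: "(('a \<Rightarrow>\<^sub>L real) \<Rightarrow> real) set" where "K = {\<xi>. \<forall>\<phi>. \<xi> \<phi> \<in> {- (norm \<phi> * R)..norm \<phi> * R}}"
  have "\<bar>h i \<phi>\<bar> \<le> norm \<phi> * R" for i \<phi>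
    using abs_blinfun_le[OF bd] by (simp add: h_def)
  then have "h i \<in> K" for i
    by (auto simp: K_def abs_le_iff minus_le_iff)
  moreover have "compact K"
    unfolding K_def by (intro compact_product) auto
  moreover have "filtermap h F \<noteq> bot"
    using \<open>F \<noteq> bot\<close> by (simp add: filtermap_bot_iff)
  ultimately obtain \<xi> where \<xi>: "\<xi> \<in> K" "inf (nhds \<xi>) (filtermap h F) \<noteq> bot"
    unfolding compact_filter by (metis eventually_filtermap always_eventually)
  \<comment> \<open>Neighbourhoods of the cluster point are pulled back to the index set, which
    makes \<open>h\<close> converge along \<open>G\<close>.\<close>
  define G where "G = inf F (filtercomap h (nhds \<xi>))"
  have "G \<noteq> bot"
  proof
    assume "G = bot"
    then have "eventually (\<lambda>_. False) G" by simp
    then obtain P Q where "eventually P F" "eventually Q (nhds \<xi>)" "\<And>i. P i \<Longrightarrow> \<not> Q (h i)"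
      unfolding G_def eventually_inf eventually_filtercomap by metis
    then have "eventually (\<lambda>_. False) (inf (nhds \<xi>) (filtermap h F))"
      unfolding eventually_inf eventually_filtermap
      by (intro exI[of _ Q] exI[of _ "\<lambda>\<eta>. \<not> Q \<eta>"]) (auto elim: eventually_mono)
    with \<xi>(2) show False by (simp add: trivial_limit_def)
  qed
  have "G \<le> F" by (simp add: G_def)
  have "filterlim h (nhds \<xi>) G"
    unfolding G_def filterlim_iff_le_filtercomap by simp
  then have lim: "((\<lambda>i. \<phi> (x i)) \<longlongrightarrow> \<xi> \<phi>) G" for \<phi> :: "'a \<Rightarrow>\<^sub>L real"
    unfolding tendsto_fun_iff by (simp add: h_def)
  have "bounded_linear \<xi>"
  proof (rule bounded_linear_intro[where K = R])
    fix \<phi> \<psi> :: "'a \<Rightarrow>\<^sub>L real" and c :: real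
    show "\<xi> (\<phi> + \<psi>) = \<xi> \<phi> + \<xi> \<psi>"
      using tendsto_unique[OF \<open>G \<noteq> bot\<close> lim[of "\<phi> + \<psi>"]] tendsto_add[OF lim[of \<phi>] lim[of \<psi>]]
      by (simp add: blinfun.add_left)
    show "\<xi> (c *\<^sub>R \<phi>) = c *\<^sub>R \<xi> \<phi>"
      using tendsto_unique[OF \<open>G \<noteq> bot\<close> lim[of "c *\<^sub>R \<phi>"]] tendsto_mult[OF tendsto_const lim[of \<phi>], of c]
      by (simp add: blinfun.scaleR_left)
    show "norm (\<xi> \<phi>) \<le> norm \<phi> * R"
      using \<xi>(1) by (auto simp: K_def abs_le_iff minus_le_iff)
  qed
  moreover obtain z where "bidual_embedding z = Blinfun \<xi>"
    using refl unfolding reflexive_space_def by (metis surjD)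
  ultimately have "\<xi> \<phi> = \<phi> z" for \<phi> :: "'a \<Rightarrow>\<^sub>L real"
    by (metis bidual_embedding_apply bounded_linear_Blinfun_apply)
  with lim \<open>G \<noteq> bot\<close> \<open>G \<le> F\<close> show ?thesis by auto
qed

text \<open>
  If every \<open>y\<close> violated some inequality, weighting the points of \<open>J\<close> by the violations would give a
  barycentre \<open>y\<close> at which the weighted sum of the pairings is negative; in that sum the terms with
  \<open>A y - f\<close> cancel, and the rest is nonnegative by symmetrisation.
\<close>

lemma finite_monotone_inequalities:
  fixes A N :: "'a::real_normed_vector \<Rightarrow> 'a \<Rightarrow>\<^sub>L real"
  assumes A: "continuous_on UNIV A" and N: "monotone_operator N" and "finite J"
  shows "\<exists>y. \<forall>v\<in>J. 0 \<le> (N v + A y - f) (v - y)"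
proof (rule ccontr)
  assume neg: "\<nexists>y. \<forall>v\<in>J. 0 \<le> (N v + A y - f) (v - y)"
  define \<alpha> where "\<alpha> v y = max 0 (- (N v + A y - f) (v - y))" for v y
  have \<alpha>: "0 \<le> \<alpha> v y" for v y by (simp add: \<alpha>_def)
  have pos: "0 < (\<Sum>v\<in>J. \<alpha> v y)" for y
  proof -
    obtain v where "v \<in> J" "(N v + A y - f) (v - y) < 0" using neg by (meson not_le)
    then show ?thesis using \<open>finite J\<close> by (intro sum_pos2[of _ v]) (auto simp: \<alpha>_def)
  qed
  have "\<exists>y. (\<Sum>v\<in>J. \<alpha> v y) *\<^sub>R y = (\<Sum>v\<in>J. \<alpha> v y *\<^sub>R v)"
    using \<open>finite J\<close> \<alpha> pos unfolding \<alpha>_def by (intro weighted_fixed_point continuous_intros A) auto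
  then obtain y where y: "(\<Sum>v\<in>J. \<alpha> v y) *\<^sub>R y = (\<Sum>v\<in>J. \<alpha> v y *\<^sub>R v)" ..
  define a where "a v = \<alpha> v y" for v
  define \<sigma> where "\<sigma> = sum a J"
  have a: "0 \<le> a v" "0 < \<sigma>" for v using \<alpha> pos by (auto simp: a_def \<sigma>_def)
  have bary: "\<sigma> *\<^sub>R y = (\<Sum>v\<in>J. a v *\<^sub>R v)" using y by (simp add: a_def \<sigma>_def)
  have diff: "(\<Sum>v\<in>J. a v *\<^sub>R (v - y)) = 0"
    using bary by (simp add: scaleR_diff_right sum_subtractf \<sigma>_def scaleR_sum_left)
  \<comment> \<open>A positive weight \<open>a v\<close> is minus the corresponding pairing, so each
    term is zero or minus a square, and some weight is positive.\<close>
  have "(\<Sum>v\<in>J. a v * (N v + A y - f) (v - y)) < 0"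
  proof -
    have "\<exists>v\<in>J. 0 < a v" using a(2) unfolding \<sigma>_def by (meson not_le sum_nonpos)
    then obtain w where w: "w \<in> J" "0 < a w" by blast
    have neg_prod: "0 \<le> - (a v * (N v + A y - f) (v - y))" for v
      by (auto simp: a_def \<alpha>_def max_def mult_le_0_iff)
    have "0 < - (a w * (N w + A y - f) (w - y))"
      using w(2) by (auto simp: a_def \<alpha>_def max_def mult_neg_neg mult_pos_neg split: if_splits)
    then have "0 < (\<Sum>v\<in>J. - (a v * (N v + A y - f) (v - y)))"
      using neg_prod by (intro sum_pos2[OF \<open>finite J\<close> w(1)])
    then show ?thesis by (simp add: sum_negf)
  qed
  moreover have "(\<Sum>v\<in>J. a v * (N v + A y - f) (v - y)) = (\<Sum>v\<in>J. a v * N v (v - y))"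
  proof -
    have "(\<Sum>v\<in>J. a v * (A y - f) (v - y)) = (A y - f) (\<Sum>v\<in>J. a v *\<^sub>R (v - y))"
      by (simp add: blinfun.sum_right blinfun.scaleR_right)
    then have "(\<Sum>v\<in>J. a v * (A y - f) (v - y)) = 0" by (simp add: diff)
    then show ?thesis
      by (simp add: blinfun.add_left blinfun.diff_left algebra_simps sum.distrib sum_subtractf)
  qed
  moreover have "0 \<le> (\<Sum>v\<in>J. a v * N v (v - y))"
  proof -
    let ?d = "\<lambda>v w. a v * a w * N v (v - w)"
    \<comment> \<open>Multiplication by \<open>\<sigma>\<close> allows
      \<open>\<sigma> *\<^sub>R y\<close> to be replaced by the weighted sum, which produces a
      double sum ready for symmetrisation.\<close>
    have "\<sigma> * (\<Sum>v\<in>J. a v * N v (v - y)) = (\<Sum>v\<in>J. \<Sum>w\<in>J. ?d v w)"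
    proof -
      have "\<sigma> * (a v * N v (v - y)) = (\<Sum>w\<in>J. ?d v w)" for v
      proof -
        have "\<sigma> * N v (v - y) = N v (\<Sum>w\<in>J. a w *\<^sub>R (v - w))"
          by (simp add: scaleR_diff_right sum_subtractf flip: scaleR_sum_left \<sigma>_def bary)
            (simp add: blinfun.scaleR_right flip: scaleR_diff_right)
        then have "a v * (\<sigma> * N v (v - y)) = a v * (\<Sum>w\<in>J. a w * N v (v - w))"
          by (simp add: blinfun.sum_right blinfun.scaleR_right)
        then show ?thesis
          by (simp add: sum_distrib_left mult_ac)
      qed
      then show ?thesis by (simp add: sum_distrib_left)
    qed
    also have "\<dots> = (\<Sum>v\<in>J. \<Sum>w\<in>J. (?d v w + ?d w v) / 2)"
    proof -
      have "(\<Sum>v\<in>J. \<Sum>w\<in>J. ?d v w) = (\<Sum>v\<in>J. \<Sum>w\<in>J. ?d w v)" by (rule sum.swap)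
      then show ?thesis by (simp add: sum.distrib flip: sum_divide_distrib)
    qed
    also have "\<dots> \<ge> 0"
    proof (intro sum_nonneg)
      fix v w
      have "?d v w + ?d w v = a v * a w * (N v - N w) (v - w)"
        by (simp add: blinfun.diff_left blinfun.diff_right algebra_simps)
      then show "0 \<le> (?d v w + ?d w v) / 2"
        using N a(1) by (simp add: monotone_operator_def)
    qed
    finally show ?thesis using a(2) by (simp add: zero_le_mult_iff)
  qed
  ultimately show False by simp
qed

section \<open>Minty's argument and the Browder-Minty theorem\<close>

text \<open>Minty's trick: take \<open>v = z + s *\<^sub>R w\<close>, divide by \<open>s > 0\<close>
  and let \<open>s\<close> tend to 0; then use both \<open>w\<close> and \<open>- w\<close>.\<close>

lemma radially_continuous_Minty:
  fixes T :: "'a::real_normed_vector \<Rightarrow> 'a \<Rightarrow>\<^sub>L real"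
  assumes T: "radially_continuous T" and ineq: "\<And>v. 0 \<le> (T v - f) (v - z)"
  shows "T z = f"
proof -
  have nonneg: "0 \<le> (T z - f) w" for w
  proof -
    have "isCont (\<lambda>s. T (z + s *\<^sub>R w) w) 0"
      using T by (simp add: radially_continuous_def continuous_on_eq_continuous_at)
    then have "((\<lambda>s. T (z + s *\<^sub>R w) w) \<longlongrightarrow> T (z + 0 *\<^sub>R w) w) (at 0)"
      by (simp only: isCont_def)
    then have "((\<lambda>s. T (z + s *\<^sub>R w) w) \<longlongrightarrow> T (z + 0 *\<^sub>R w) w) (at_right 0)"
      by (rule tendsto_mono[OF at_le, rotated]) simp
    moreover have "eventually (\<lambda>s. f w \<le> T (z + s *\<^sub>R w) w) (at_right 0)"
      using eventually_at_right_less[of 0]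
    proof eventually_elim
      case (elim s)
      then show ?case using ineq[of "z + s *\<^sub>R w"]
        by (simp add: blinfun.scaleR_right zero_le_mult_iff blinfun.diff_left)
    qed
    ultimately have "f w \<le> T z w"
      using tendsto_lowerbound[of "\<lambda>s. T (z + s *\<^sub>R w) w" "T (z + 0 *\<^sub>R w) w" "at_right 0" "f w"] by simp
    then show ?thesis by (simp add: blinfun.diff_left)
  qed
  show ?thesis
  proof (rule blinfun_eqI)
    fix w show "T z w = f w"
      using nonneg[of w] nonneg[of "- w"] by (simp add: blinfun.diff_left blinfun.minus_right)
  qed
qed

lemma norm_le_of_coercive:
  fixes \<phi> :: "'a::real_normed_vector \<Rightarrow>\<^sub>L real"
  assumes "c * (norm u)\<^sup>2 \<le> \<phi> u"
  shows "c * norm u \<le> norm \<phi>"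
proof -
  have "c * (norm u)\<^sup>2 \<le> norm \<phi> * norm u"
    using assms norm_blinfun[of \<phi> u] by simp
  then have "norm u * (c * norm u) \<le> norm u * norm \<phi>"
    by (simp add: power2_eq_square mult_ac)
  then show ?thesis
    by (metis mult_le_cancel_left_pos mult_zero_right norm_ge_zero order_le_less)
qed

text \<open>The inequalities are solved for each finite set of test points, with 0 always included
  to bound the solutions by \<open>R\<close>. A weak cluster point along growing finite sets
  satisfies all of them, and Minty's argument turns this into the equation.\<close>

theorem browder_minty:
  fixes A N :: "'a::real_normed_vector \<Rightarrow> 'a \<Rightarrow>\<^sub>L real"
  assumes refl: "reflexive_space TYPE('a)"
    and A: "bounded_linear A" and coer: "c > 0" "\<And>u. c * (norm u)\<^sup>2 \<le> A u u"
    and N: "monotone_operator N" "radially_continuous N"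
  shows "\<exists>y. A y + N y = f"
proof -
  interpret A: bounded_linear A by fact
  have contA: "continuous_on S A" for S by (rule A.continuous_on) (rule continuous_on_id)
  define R where "R = norm (f - N 0) / c"
  have fin: "\<exists>y. \<forall>v\<in>insert 0 J. 0 \<le> (N v + A y - f) (v - y)" if "finite J" for J
    using that by (intro finite_monotone_inequalities contA N) auto
  have bound: "norm y \<le> R" if y: "0 \<le> (N 0 + A y - f) (0 - y)" for y
  proof -
    have "c * (norm y)\<^sup>2 \<le> (f - N 0) y"
      using y coer(2)[of y] by (simp add: blinfun.minus_right blinfun.add_left blinfun.diff_left)
    then have "c * norm y \<le> norm (f - N 0)"
      by (rule norm_le_of_coercive)
    then show ?thesis using coer(1) by (auto simp: R_def field_simps)
  qed
  \<comment> \<open>Infinite sets \<open>J\<close> get the value 0, so that the bound holds for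
    every index; they are invisible to \<open>finite_subsets_at_top\<close>.\<close>
  have "\<exists>y. norm y \<le> R \<and> (finite J \<longrightarrow> (\<forall>v\<in>J. 0 \<le> (N v + A y - f) (v - y)))" for J
  proof (cases "finite J")
    case True
    with fin obtain y where "\<forall>v\<in>insert 0 J. 0 \<le> (N v + A y - f) (v - y)" by blast
    with bound show ?thesis by blast
  next
    case False
    then show ?thesis using coer(1) by (intro exI[of _ 0]) (simp add: R_def)
  qed
  then have "\<exists>y. \<forall>J. norm (y J) \<le> R \<and> (finite J \<longrightarrow> (\<forall>v\<in>J. 0 \<le> (N v + A (y J) - f) (v - y J)))"
    by (intro choice allI)
  then obtain y where y: "\<And>J. norm (y J) \<le> R"
    "\<And>J v. finite J \<Longrightarrow> v \<in> J \<Longrightarrow> 0 \<le> (N v + A (y J) - f) (v - y J)"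
    by blast
  obtain z G where G: "G \<noteq> bot" "G \<le> finite_subsets_at_top UNIV"
    and lim: "\<And>\<phi>::'a \<Rightarrow>\<^sub>L real. ((\<lambda>J. \<phi> (y J)) \<longlongrightarrow> \<phi> z) G"
    using weak_cluster_point[where x = y, OF refl finite_subsets_at_top_neq_bot y(1), of UNIV] by blast
  have "0 \<le> (A v + N v - f) (v - z)" for v
  proof -
    have "eventually (\<lambda>J. finite J \<and> v \<in> J) (finite_subsets_at_top UNIV)"
      unfolding eventually_finite_subsets_at_top by (intro exI[of _ "{v}"]) auto
    then have "eventually (\<lambda>J. finite J \<and> v \<in> J) G"
      using G(2) by (simp add: filter_leD)
    then have "eventually (\<lambda>J. 0 \<le> (A v + N v - f) v - (A v + N v - f) (y J)) G"
    proof eventually_elim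
      case (elim J)
      \<comment> \<open>Monotonicity of \<open>A\<close> replaces \<open>A (y J)\<close> by
        \<open>A v\<close>. The expression becomes affine in \<open>y J\<close> and passes to the
        weak limit.\<close>
      have "0 \<le> c * (norm (v - y J))\<^sup>2" using coer(1) by simp
      also have "\<dots> \<le> A (v - y J) (v - y J)" by (rule coer)
      finally show ?case using y(2)[of J v] elim
        by (simp add: A.diff blinfun.diff_left blinfun.diff_right blinfun.add_left)
    qed
    moreover have "((\<lambda>J. (A v + N v - f) v - (A v + N v - f) (y J)) \<longlongrightarrow>
        (A v + N v - f) v - (A v + N v - f) z) G"
      by (intro tendsto_intros lim)
    ultimately have "0 \<le> (A v + N v - f) v - (A v + N v - f) z"
      using G(1) tendsto_lowerbound by blast
    then show ?thesis by (simp add: blinfun.diff_right)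
  qed
  moreover have "radially_continuous (\<lambda>v. A v + N v)"
    unfolding radially_continuous_def blinfun.add_left
  proof (intro allI continuous_on_add)
    fix x w
    show "continuous_on UNIV (\<lambda>s. A (x + s *\<^sub>R w) w)"
      by (intro continuous_intros A.continuous_on)
    show "continuous_on UNIV (\<lambda>s. N (x + s *\<^sub>R w) w)"
      using N(2) by (simp add: radially_continuous_def)
  qed
  ultimately show ?thesis
    using radially_continuous_Minty[of "\<lambda>v. A v + N v" f z] by blast
qed

text \<open>
  Pass to a subsequence along which \<open>\<langle>A x\<^sub>k, x\<^sub>n\<rangle>\<close> converges for every \<open>k\<close>.  For two weak cluster points
  \<open>z, z'\<close> the functional \<open>\<langle>A \<cdot>, z - z'\<rangle>\<close> vanishes on the sequence, hence at \<open>z\<close> and \<open>z'\<close>, so \<open>z = z'\<close>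
  by coercivity; a bounded sequence with a unique weak cluster point converges weakly.
\<close>

lemma coercive_weakly_sequentially_compact:
  fixes A :: "'a::real_normed_vector \<Rightarrow> 'a \<Rightarrow>\<^sub>L real" and x :: "nat \<Rightarrow> 'a"
  assumes refl: "reflexive_space TYPE('a)"
    and A: "bounded_linear A" and coer: "c > 0" "\<And>u. c * (norm u)\<^sup>2 \<le> A u u"
    and bd: "\<And>n. norm (x n) \<le> R"
  shows "\<exists>h z. strict_mono h \<and> weakly_converges (\<lambda>n. x (h n)) z"
proof -
  define q where "q n k = A (x k) (x n)" for n k
  have "\<bar>q n k\<bar> \<le> norm (A (x k)) * R" for n k
    using abs_blinfun_le[OF bd] by (simp add: q_def)
  then have q: "q n k \<in> {- (norm (A (x k)) * R)..norm (A (x k)) * R}" for n k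
    by (simp add: abs_le_iff minus_le_iff)
  have "seq_compact {f :: nat \<Rightarrow> real. \<forall>k. f k \<in> {- (norm (A (x k)) * R)..norm (A (x k)) * R}}"
    by (intro compact_imp_seq_compact compact_product) auto
  then obtain l h where h: "strict_mono h" and "(q \<circ> h) \<longlonglongrightarrow> l"
    by (rule seq_compactE[where f = q]) (use q in blast)
  then have l: "(\<lambda>n. A (x k) (x (h n))) \<longlonglongrightarrow> l k" for k
    by (simp add: tendsto_fun_iff q_def)
  define cluster where "cluster G z \<longleftrightarrow> G \<noteq> bot \<and> G \<le> sequentially \<and>
    (\<forall>\<phi>::'a \<Rightarrow>\<^sub>L real. ((\<lambda>n. \<phi> (x (h n))) \<longlongrightarrow> \<phi> z) G)" for G z
  have unique: "z = z'" if "cluster G z" "cluster G' z'" for G G' z z'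
  proof -
    \<comment> \<open>Along a cluster filter the pairings with \<open>A (x k)\<close> keep the limit
      \<open>l k\<close> of the whole subsequence, so all cluster points agree on these
      functionals.\<close>
    have at: "A (x k) w = l k" if "cluster H w" for k w H
      using that tendsto_unique[of H "\<lambda>n. A (x k) (x (h n))"] tendsto_mono[OF _ l, of H k]
      by (auto simp: cluster_def)
    define \<psi> where "\<psi> = Blinfun (\<lambda>v. A v (z - z'))"
    have \<psi>: "\<psi> v = A v (z - z')" for v
      unfolding \<psi>_def
      by (simp add: bounded_linear_Blinfun_apply bounded_linear_compose[OF blinfun.bounded_linear_left A])
    have "\<psi> (x k) = 0" for k
      using at that by (simp add: \<psi> blinfun.diff_right)
    have zero: "\<psi> w = 0" if w: "cluster H w" for w H
    proof -
      have "((\<lambda>n. \<psi> (x (h n))) \<longlongrightarrow> \<psi> w) H" "H \<noteq> bot"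
        using w by (simp_all add: cluster_def)
      then show ?thesis using \<open>\<And>k. \<psi> (x k) = 0\<close> by (simp add: tendsto_const_iff)
    qed
    have "A (z - z') (z - z') = 0"
      using zero[OF that(1)] zero[OF that(2)] \<psi>[of "z - z'"] by (simp add: blinfun.diff_right[of \<psi>])
    then show ?thesis
      using coer(1) coer(2)[of "z - z'"] by (simp add: mult_le_0_iff)
  qed
  have ex: "\<exists>z G. cluster G z \<and> G \<le> F" if "F \<noteq> bot" "F \<le> sequentially" for F
    using weak_cluster_point[OF refl that(1), of "\<lambda>n. x (h n)" R] bd that(2)
    unfolding cluster_def by (meson order_trans)
  obtain z G where z: "cluster G z"
    using ex[of sequentially] by auto
  have "(\<lambda>n. \<phi> (x (h n))) \<longlonglongrightarrow> \<phi> z" for \<phi> :: "'a \<Rightarrow>\<^sub>L real"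
  proof (rule ccontr)
    assume "\<not> (\<lambda>n. \<phi> (x (h n))) \<longlonglongrightarrow> \<phi> z"
    then obtain \<epsilon> where \<epsilon>: "\<epsilon> > 0" "\<not> eventually (\<lambda>n. dist (\<phi> (x (h n))) (\<phi> z) < \<epsilon>) sequentially"
      unfolding tendsto_iff by blast
    \<comment> \<open>\<open>F\<close> lives on the indices that stay away from the limit; a cluster
      point along it must again be \<open>z\<close>, a contradiction.\<close>
    define F where "F = inf sequentially (principal {n. \<not> dist (\<phi> (x (h n))) (\<phi> z) < \<epsilon>})"
    have "F \<noteq> bot"
      using \<epsilon>(2) by (auto simp: F_def trivial_limit_def eventually_inf_principal elim: eventually_mono)
    then obtain z' G' where z': "cluster G' z'" "G' \<le> F"
      using ex[of F] by (auto simp: F_def)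
    have "eventually (\<lambda>n. dist (\<phi> (x (h n))) (\<phi> z) < \<epsilon>) G'"
      using z'(1) \<epsilon>(1) unique[OF z z'(1)] by (auto simp: cluster_def tendsto_iff)
    moreover have "eventually (\<lambda>n. \<not> dist (\<phi> (x (h n))) (\<phi> z) < \<epsilon>) G'"
      by (rule filter_leD[OF z'(2)]) (simp add: F_def eventually_inf_principal)
    ultimately have "eventually (\<lambda>_. False) G'"
      by eventually_elim blast
    with z'(1) show False by (simp add: cluster_def trivial_limit_def)
  qed
  with h show ?thesis unfolding weakly_converges_def by blast
qed

section \<open>Weak convergence and complete continuity\<close>

lemma tendsto_imp_weakly_converges:
  assumes "x \<longlonglongrightarrow> l"
  shows "weakly_converges x l"
  using assms by (auto simp: weakly_converges_def intro!: tendsto_intros)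

lemma weakly_converges_diff:
  assumes "weakly_converges x l" "weakly_converges y k"
  shows "weakly_converges (\<lambda>n. x n - y n) (l - k)"
  using assms by (auto simp: weakly_converges_def blinfun.diff_right intro!: tendsto_diff)

lemma completely_continuous_imp_continuous_on:
  fixes R :: "'a::banach \<Rightarrow> 'b::banach"
  assumes "completely_continuous R"
  shows "continuous_on S R"
proof (rule continuous_on_sequentiallyI)
  fix u :: "nat \<Rightarrow> 'a" and a assume "u \<longlonglongrightarrow> a"
  then show "(\<lambda>n. R (u n)) \<longlonglongrightarrow> R a"
    using assms tendsto_imp_weakly_converges unfolding completely_continuous_def by blast
qed

text \<open>Split off the pairing with \<open>\<phi> n - \<psi>\<close>, which is at most
  \<open>norm (\<phi> n - \<psi>) * B\<close>; the rest is weak convergence tested with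
  \<open>\<psi>\<close>.\<close>

lemma tendsto_weak_pairing:
  fixes \<phi> :: "nat \<Rightarrow> 'a::real_normed_vector \<Rightarrow>\<^sub>L real"
  assumes \<phi>: "\<phi> \<longlonglongrightarrow> \<psi>" and x: "weakly_converges x l" and bd: "\<And>n. norm (x n) \<le> B"
  shows "(\<lambda>n. blinfun_apply (\<phi> n) (x n)) \<longlonglongrightarrow> blinfun_apply \<psi> l"
proof -
  have "(\<lambda>n. norm (\<phi> n - \<psi>) * B) \<longlonglongrightarrow> 0"
    using tendsto_mult_left_zero[OF tendsto_norm_zero[OF LIM_zero[OF \<phi>]]] by simp
  then have "(\<lambda>n. blinfun_apply (\<phi> n - \<psi>) (x n)) \<longlonglongrightarrow> 0"
    by (rule Lim_null_comparison[rotated])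
      (use abs_blinfun_le[OF bd] in \<open>simp add: always_eventually\<close>)
  moreover have "(\<lambda>n. blinfun_apply \<psi> (x n)) \<longlonglongrightarrow> blinfun_apply \<psi> l"
    using x by (simp add: weakly_converges_def)
  ultimately show ?thesis
    using tendsto_add by (fastforce simp: blinfun.diff_left)
qed

section \<open>A priori bound and solvability in the completely continuous case\<close>

text \<open>Test the equation with \<open>x - v\<close> and drop the term in \<open>p\<close>. If
  \<open>norm x > 1\<close>, the right-hand side is at most linear in \<open>norm x\<close>, and one
  factor cancels; the summand 1 covers the other case. The bound does not involve \<open>p\<close>,
  hence is uniform in the penalty parameter.\<close>

lemma a_priori_bound:
  fixes A :: "'a::real_normed_vector \<Rightarrow> 'a \<Rightarrow>\<^sub>L real"
  assumes K: "\<And>u. norm (A u) \<le> norm u * K" and coer: "c > 0" "\<And>u. c * (norm u)\<^sup>2 \<le> A u u"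
    and eq: "A x + p = g" and p: "0 \<le> p (x - v)" and g: "norm g \<le> b"
  shows "norm x \<le> 1 + (b + K * norm v + b * norm v) / c"
proof (cases "norm x \<le> 1")
  case True
  have "0 \<le> b" using g norm_ge_zero order_trans by blast
  moreover have "0 \<le> K * norm v"
    using order_trans[OF norm_ge_zero K[of v]] by (simp add: mult.commute)
  ultimately show ?thesis
    using True coer(1) by (simp add: add_increasing2)
next
  case False
  have b: "0 \<le> b" using g norm_ge_zero order_trans by blast
  have "c * (norm x)\<^sup>2 \<le> A x x" by (rule coer)
  also have "A x x = g (x - v) - p (x - v) + A x v"
    unfolding eq[symmetric] by (simp add: blinfun.add_left blinfun.diff_right)
  also have "\<dots> \<le> b * (norm x + norm v) + norm x * K * norm v"
  proof -
    have "g (x - v) \<le> norm g * norm (x - v)" using norm_blinfun[of g "x - v"] by simp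
    also have "\<dots> \<le> b * (norm x + norm v)"
      using g b by (intro mult_mono norm_triangle_ineq4) auto
    finally have 1: "g (x - v) \<le> b * (norm x + norm v)" .
    have "A x v \<le> norm (A x) * norm v" using norm_blinfun[of "A x" v] by simp
    also have "\<dots> \<le> norm x * K * norm v" using K by (intro mult_right_mono) auto
    finally show ?thesis using 1 p by simp
  qed
  also have "\<dots> \<le> (b + K * norm v + b * norm v) * norm x"
  proof -
    have "b * norm v * 1 \<le> b * norm v * norm x"
      using False b by (intro mult_left_mono) auto
    then show ?thesis by (simp add: algebra_simps)
  qed
  finally have "(c * norm x) * norm x \<le> (b + K * norm v + b * norm v) * norm x"
    by (simp add: power2_eq_square)
  then have "c * norm x \<le> b + K * norm v + b * norm v"
    by (rule mult_right_le_imp_le) (use False in linarith)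
  then have "norm x \<le> (b + K * norm v + b * norm v) / c"
    using coer(1) by (simp add: field_simps)
  then show ?thesis by simp
qed

text \<open>Solutions are the fixed points of \<open>S (f - M y)\<close> with \<open>S\<close> the
  inverse of \<open>A\<close>. Precomposing \<open>M\<close> with a retraction onto a ball gives the
  compact range that Schauder's theorem asks for; the sign condition on \<open>M\<close> bounds the
  fixed point.\<close>

lemma solvable_completely_continuous:
  fixes A M :: "'a::banach \<Rightarrow> 'a \<Rightarrow>\<^sub>L real"
  assumes refl: "reflexive_space TYPE('a)"
    and A: "bounded_linear A" and coer: "c > 0" "\<And>u. c * (norm u)\<^sup>2 \<le> A u u"
    and M: "completely_continuous M" and v: "\<And>y. 0 \<le> M y (y - v)"
  shows "\<exists>y. A y + M y = f"
proof -
  interpret A: bounded_linear A by fact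
  obtain K where K: "\<And>u. norm (A u) \<le> norm u * K" "0 \<le> K" using A.nonneg_bounded by blast
  \<comment> \<open>The Lax-Milgram theorem, as the case of zero perturbation.\<close>
  have "\<exists>y. A y = \<phi>" for \<phi>
    using browder_minty[OF refl A coer, of "\<lambda>_. 0" \<phi>]
    by (simp add: monotone_operator_def radially_continuous_def)
  then have "\<exists>S. \<forall>\<phi>. A (S \<phi>) = \<phi>"
    by (intro choice allI)
  then obtain S where S: "\<And>\<phi>. A (S \<phi>) = \<phi>" by blast
  have below: "c * norm u \<le> norm (A u)" for u
    using coer(2) by (rule norm_le_of_coercive)
  have "(1 / c)-lipschitz_on UNIV S"
  proof (rule lipschitz_onI)
    show "dist (S \<phi>) (S \<psi>) \<le> 1 / c * dist \<phi> \<psi>" for \<phi> \<psi>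
      using coer(1) below[of "S \<phi> - S \<psi>"] by (simp add: dist_norm A.diff S field_simps)
  qed (use coer(1) in simp)
  then have contS: "continuous_on UNIV S"
    by (rule lipschitz_on_continuous_on)
  \<comment> \<open>\<open>R\<close> exceeds the a priori bound by \<open>1\<close>, so a fixed point that is changed by the retraction \<open>r\<close>
    onto the ball of radius \<open>R\<close> would violate that bound (Schaefer's argument).\<close>
  define R where "R = 2 + (norm f + K * norm v + norm f * norm v) / c"
  have R: "R > 0"
    using coer(1) K(2) by (simp add: R_def add_pos_nonneg)
  define r where "r y = (R / max R (norm y)) *\<^sub>R y" for y :: 'a
  have contr: "continuous_on UNIV r"
    unfolding r_def using R by (intro continuous_intros) (auto simp: max_def)
  \<comment> \<open>This superset of the ball is weakly closed without appeal to the Hahn--Banach theorem.\<close>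
  define Z :: "'a set" where "Z = {z. \<forall>\<phi>. blinfun_apply \<phi> z \<le> norm \<phi> * R}"
  have rZ: "r y \<in> Z" for y
  proof -
    have "norm (r y) \<le> R"
      using R by (auto simp: r_def max_def divide_simps)
    then show ?thesis
      unfolding Z_def using order_trans[OF abs_ge_self abs_blinfun_le] by blast
  qed
  \<comment> \<open>The functional \<open>A z\<close> itself is the test in the definition of
    \<open>Z\<close>; coercivity then bounds \<open>z\<close>.\<close>
  have Zbd: "norm z \<le> K * R / c" if "z \<in> Z" for z
  proof (cases "z = 0")
    case True
    then show ?thesis using coer(1) K(2) R by simp
  next
    case False
    have "c * (norm z)\<^sup>2 \<le> norm (A z) * R"
      using coer(2)[of z] that by (auto simp: Z_def intro: order_trans)
    also have "\<dots> \<le> norm z * K * R" using K R by (intro mult_right_mono) auto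
    finally show ?thesis using False coer(1) by (simp add: power2_eq_square field_simps)
  qed
  have "compact (M ` Z)"
    unfolding compact_eq_seq_compact_metric
  proof (rule seq_compactI)
    fix g :: "nat \<Rightarrow> 'a \<Rightarrow>\<^sub>L real" assume "\<forall>n. g n \<in> M ` Z"
    then have "\<exists>z. \<forall>n. z n \<in> Z \<and> g n = M (z n)" by (intro choice) blast
    then obtain z where z: "\<And>n. z n \<in> Z" "g = (\<lambda>n. M (z n))" by blast
    obtain h l where h: "strict_mono h" and l: "weakly_converges (\<lambda>n. z (h n)) l"
      using coercive_weakly_sequentially_compact[where x = z, OF refl A coer Zbd[OF z(1)]] by blast
    have "\<phi> l \<le> norm \<phi> * R" for \<phi> :: "'a \<Rightarrow>\<^sub>L real"
      using l z(1) by (intro LIMSEQ_le_const2[of "\<lambda>n. \<phi> (z (h n))"]) (auto simp: weakly_converges_def Z_def)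
    then have "M l \<in> M ` Z" by (simp add: Z_def)
    moreover have "(g \<circ> h) \<longlonglongrightarrow> M l"
      using M l by (simp add: completely_continuous_def z(2) o_def)
    ultimately show "\<exists>l\<in>M ` Z. \<exists>r. strict_mono r \<and> (g \<circ> r) \<longlonglongrightarrow> l"
      using h by blast
  qed
  then have "compact ((\<lambda>\<phi>. S (f - \<phi>)) ` M ` Z)"
    by (rule compact_continuous_image[rotated])
      (intro continuous_on_compose2[OF contS] continuous_intros, auto)
  moreover have "continuous_on UNIV (\<lambda>y. S (f - M (r y)))"
    by (intro continuous_on_compose2[OF contS] continuous_intros
        continuous_on_compose2[OF completely_continuous_imp_continuous_on[OF M] contr]) auto
  ultimately have "\<exists>y. S (f - M (r y)) = y"
    using rZ by (intro schauder[of _ "(\<lambda>\<phi>. S (f - \<phi>)) ` M ` Z"]) auto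
  then obtain y where "S (f - M (r y)) = y" ..
  then have y: "A y + M (r y) = f"
    using S[of "f - M (r y)"] by simp
  show ?thesis
  proof (cases "norm y \<le> R")
    case True
    then have "r y = y" using R by (simp add: r_def max_def)
    with y show ?thesis by auto
  next
    case False
    define t where "t = R / norm y"
    have t: "0 \<le> t" "t \<le> 1" and ry: "r y = t *\<^sub>R y"
      using False R by (auto simp: t_def r_def max_def divide_le_eq)
    \<comment> \<open>Scaling by \<open>t\<close> gives an equation for \<open>r y\<close> whose
      data are no larger and whose perturbation keeps its sign, so
      \<open>norm (r y) \<le> R - 1\<close>, although \<open>norm (r y) = R\<close>.\<close>
    have eq: "A (r y) + t *\<^sub>R M (r y) = t *\<^sub>R f"
      by (simp add: ry A.scaleR flip: y scaleR_add_right)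
    have "0 \<le> (t *\<^sub>R M (r y)) (r y - v)"
      using t v by (simp add: blinfun.scaleR_left)
    moreover have "norm (t *\<^sub>R f) \<le> norm f"
      using t by (simp add: mult_left_le_one_le)
    ultimately have "norm (r y) \<le> R - 1"
      using a_priori_bound[OF K(1) coer eq] by (simp add: R_def)
    moreover have "norm (r y) = R"
      using False R by (auto simp: ry t_def)
    ultimately show ?thesis by simp
  qed
qed

section \<open>Penalisation\<close>

text \<open>Since \<open>T (- w) = 0\<close>, this is monotonicity between \<open>u\<close> and
  \<open>- w\<close>.\<close>

lemma penalty_nonneg:
  fixes T :: "'a::{real_normed_vector, ordered_real_vector} \<Rightarrow> 'a \<Rightarrow>\<^sub>L real"
  assumes T: "monotone_operator T" and zero: "\<And>v. v \<le> 0 \<Longrightarrow> T v = 0" and w: "0 \<le> w"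
  shows "0 \<le> T u (u + w)"
proof -
  have "T (- w) = 0" using w by (intro zero) simp
  moreover have "0 \<le> (T u - T (- w)) (u - - w)"
    using T unfolding monotone_operator_def by blast
  ultimately show ?thesis by simp
qed

lemma penalty_limit:
  fixes A :: "'a::{banach, ordered_real_vector, lattice} \<Rightarrow> 'a \<Rightarrow>\<^sub>L real"
  assumes A: "bounded_linear A" and coer: "c > 0" "\<And>u. c * (norm u)\<^sup>2 \<le> A u u"
    and m: "penalty_maps m" and \<Phi>: "completely_continuous \<Phi>"
    and r: "\<And>n. r n > 0" "r \<longlonglongrightarrow> 0"
    and eq: "\<And>n. A (y n) + (1 / r n) *\<^sub>R m (r n) (y n - \<Phi> (y n)) = g n"
    and g: "g \<longlonglongrightarrow> f"
    and y: "weakly_converges y y\<^sub>0" and bd: "\<And>n. norm (y n) \<le> B"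
  shows "y \<longlonglongrightarrow> y\<^sub>0 \<and> y\<^sub>0 \<le> \<Phi> y\<^sub>0 \<and> (\<forall>v. v \<le> \<Phi> y\<^sub>0 \<longrightarrow> (A y\<^sub>0 - f) (y\<^sub>0 - v) \<le> 0)"
proof -
  interpret A: bounded_linear A by fact
  obtain K where K: "\<And>u. norm (A u) \<le> norm u * K" "0 \<le> K" using A.nonneg_bounded by blast
  obtain b where b: "\<And>n. norm (g n) \<le> b"
    using convergent_imp_Bseq[of g] g by (auto simp: convergent_def Bseq_def)
  have mono: "monotone_operator (m (r n))" and zero: "\<And>v. v \<le> 0 \<Longrightarrow> m (r n) v = 0" for n
    using m r(1) by (auto simp: penalty_maps_def)
  have res: "norm (A (y n) - g n) \<le> B * K + b" for n
  proof -
    have "norm (A (y n)) \<le> B * K"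
      by (rule order_trans[OF K(1) mult_right_mono[OF bd K(2)]])
    then show ?thesis using b[of n] norm_triangle_ineq4[of "A (y n)" "g n"] by linarith
  qed
  define d where "d n = \<Phi> (y n) - \<Phi> y\<^sub>0" for n
  have \<Phi>y: "(\<lambda>n. \<Phi> (y n)) \<longlonglongrightarrow> \<Phi> y\<^sub>0"
    using \<Phi> y by (simp add: completely_continuous_def)
  then have d: "d \<longlonglongrightarrow> 0" unfolding d_def by (rule LIM_zero)
  have feasible: "y\<^sub>0 \<le> \<Phi> y\<^sub>0"
  proof -
    \<comment> \<open>The penalty term is \<open>r n\<close> times a bounded residual, hence tends
      to 0 in norm.\<close>
    have pen: "m (r n) (y n - \<Phi> (y n)) = r n *\<^sub>R (g n - A (y n))" for n
      using r(1)[of n] by (simp flip: eq)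
    have "(\<lambda>n. \<bar>r n\<bar> * (B * K + b)) \<longlonglongrightarrow> 0"
      using tendsto_mult_left_zero[OF tendsto_rabs_zero[OF r(2)]] .
    then have "(\<lambda>n. m (r n) (y n - \<Phi> (y n))) \<longlonglongrightarrow> 0"
      unfolding pen
      by (rule Lim_null_comparison[rotated])
        (use res in \<open>auto intro!: always_eventually mult_left_mono simp: norm_minus_commute\<close>)
    moreover have "weakly_converges (\<lambda>n. y n - \<Phi> (y n)) (y\<^sub>0 - \<Phi> y\<^sub>0)"
      by (intro weakly_converges_diff y tendsto_imp_weakly_converges \<Phi>y)
    ultimately have "y\<^sub>0 - \<Phi> y\<^sub>0 \<le> 0"
      using m r unfolding penalty_maps_def by blast
    then show ?thesis by simp
  qed
  \<comment> \<open>The shifted test point \<open>v + d n\<close> satisfies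
    \<open>v + d n - \<Phi> (y n) = v - \<Phi> y\<^sub>0 \<le> 0\<close>, where the penalty
    vanishes; monotonicity gives the sign.\<close>
  have ineq: "(A (y n) - g n) (y n - v - d n) \<le> 0" if v: "v \<le> \<Phi> y\<^sub>0" for v n
  proof -
    let ?u = "y n - \<Phi> (y n)" and ?w = "v - \<Phi> y\<^sub>0"
    have "m (r n) ?w = 0" using v by (intro zero) simp
    then have "0 \<le> m (r n) ?u (?u - ?w)"
      using mono[of n] unfolding monotone_operator_def by (metis diff_zero)
    moreover have "A (y n) - g n = - (1 / r n) *\<^sub>R m (r n) ?u"
      by (simp flip: eq)
    moreover have "?u - ?w = y n - v - d n" by (simp add: d_def)
    ultimately show ?thesis
      using r(1)[of n] by (simp add: blinfun.minus_left blinfun.scaleR_left)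
  qed
  have "(\<lambda>n. norm (y n - y\<^sub>0) ^ 2) \<longlonglongrightarrow> 0"
  proof (rule Lim_null_comparison)
    \<comment> \<open>\<open>?e n\<close> is the coercive term at \<open>y n - y\<^sub>0\<close>
      minus the quantity that \<open>ineq\<close> shows to be nonpositive for
      \<open>v = y\<^sub>0\<close>. Each of its three terms tends to 0.\<close>
    let ?e = "\<lambda>n. g n (y n - y\<^sub>0) + (A (y n) - g n) (d n) - A y\<^sub>0 (y n - y\<^sub>0)"
    have "c * norm (y n - y\<^sub>0) ^ 2 \<le> ?e n" for n
    proof -
      have "c * norm (y n - y\<^sub>0) ^ 2 \<le> A (y n - y\<^sub>0) (y n - y\<^sub>0)" by (rule coer)
      also have "\<dots> = ?e n + (A (y n) - g n) (y n - y\<^sub>0 - d n)"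
        by (simp add: A.diff blinfun.diff_left blinfun.diff_right)
      finally show ?thesis using ineq[OF feasible, of n] by linarith
    qed
    then show "\<forall>\<^sub>F n in sequentially. norm (norm (y n - y\<^sub>0) ^ 2) \<le> ?e n / c"
      using coer(1) by (simp add: field_simps)
    have diff: "weakly_converges (\<lambda>n. y n - y\<^sub>0) (y\<^sub>0 - y\<^sub>0)"
      by (intro weakly_converges_diff y tendsto_imp_weakly_converges tendsto_const)
    have "norm (y n - y\<^sub>0) \<le> B + norm y\<^sub>0" for n
      using bd[of n] norm_triangle_ineq4[of "y n" y\<^sub>0] by linarith
    then have "(\<lambda>n. g n (y n - y\<^sub>0)) \<longlonglongrightarrow> f (y\<^sub>0 - y\<^sub>0)"
      by (rule tendsto_weak_pairing[OF g diff])
    moreover have "(\<lambda>n. (A (y n) - g n) (d n)) \<longlonglongrightarrow> 0"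
    proof (rule Lim_null_comparison)
      show "\<forall>\<^sub>F n in sequentially. norm ((A (y n) - g n) (d n)) \<le> (B * K + b) * norm (d n)"
        by (intro always_eventually allI order_trans[OF norm_blinfun mult_right_mono[OF res norm_ge_zero]])
      show "(\<lambda>n. (B * K + b) * norm (d n)) \<longlonglongrightarrow> 0"
        using tendsto_mult_right_zero[OF tendsto_norm_zero[OF d]] .
    qed
    moreover have "(\<lambda>n. A y\<^sub>0 (y n - y\<^sub>0)) \<longlonglongrightarrow> A y\<^sub>0 (y\<^sub>0 - y\<^sub>0)"
      using diff by (simp only: weakly_converges_def)
    ultimately have "?e \<longlonglongrightarrow> f (y\<^sub>0 - y\<^sub>0) + 0 - A y\<^sub>0 (y\<^sub>0 - y\<^sub>0)"
      by (intro tendsto_diff tendsto_add)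
    then have "?e \<longlonglongrightarrow> 0" by simp
    then show "(\<lambda>n. ?e n / c) \<longlonglongrightarrow> 0" by (rule tendsto_divide_zero)
  qed
  then have strong: "y \<longlonglongrightarrow> y\<^sub>0"
    by (simp add: power_tendsto_0_iff tendsto_norm_zero_iff LIM_zero_iff)
  moreover have "(A y\<^sub>0 - f) (y\<^sub>0 - v) \<le> 0" if v: "v \<le> \<Phi> y\<^sub>0" for v
  proof (rule LIMSEQ_le_const2)
    have "(\<lambda>n. (A (y n) - g n) (y n - v - d n)) \<longlonglongrightarrow> (A y\<^sub>0 - f) (y\<^sub>0 - v - 0)"
      by (intro tendsto_intros A.tendsto strong g d)
    then show "(\<lambda>n. (A (y n) - g n) (y n - v - d n)) \<longlonglongrightarrow> (A y\<^sub>0 - f) (y\<^sub>0 - v)"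
      by simp
  qed (use ineq[OF v] in blast)
  ultimately show ?thesis using feasible by blast
qed

section \<open>Solutions of the penalised equations and their limit\<close>

theorem theorem2p18:
  fixes A :: "'a::{banach, ordered_real_vector, lattice} \<Rightarrow> 'a \<Rightarrow>\<^sub>L real"
    and \<Phi> :: "'a \<Rightarrow> 'a"
    and m :: "real \<Rightarrow> 'a \<Rightarrow> 'a \<Rightarrow>\<^sub>L real"
    and f :: "real \<Rightarrow> 'a \<Rightarrow>\<^sub>L real"
    and f\<^sub>0 :: "'a \<Rightarrow>\<^sub>L real"
  assumes "reflexive_space TYPE('a)"
    and "closed {v::'a. 0 \<le> v}"
    and "admissible_operator A"
    and "penalty_maps m"
    and "\<exists>v\<^sub>0. \<forall>v. v\<^sub>0 \<le> \<Phi> v"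
    and "(\<forall>\<rho>>0. completely_continuous (\<lambda>v. m \<rho> (v - \<Phi> v))) \<or>
         (\<forall>\<rho>>0. monotone_operator (\<lambda>v. m \<rho> (v - \<Phi> v)) \<and>
                 radially_continuous (\<lambda>v. m \<rho> (v - \<Phi> v)) \<and>
                 bounded_operator (\<lambda>v. m \<rho> (v - \<Phi> v)))"
    and "completely_continuous \<Phi>"
    and "(f \<longlongrightarrow> f\<^sub>0) (at_right 0)"
  shows "\<exists>(r :: nat \<Rightarrow> real) (y :: nat \<Rightarrow> 'a) (y\<^sub>0 :: 'a).
           (\<forall>n. r n > 0) \<and> r \<longlonglongrightarrow> 0 \<and>
           (\<forall>n. A (y n) + (1 / r n) *\<^sub>R m (r n) (y n - \<Phi> (y n)) = f (r n)) \<and>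
           y \<longlonglongrightarrow> y\<^sub>0 \<and>
           y\<^sub>0 \<le> \<Phi> y\<^sub>0 \<and>
           (\<forall>v. v \<le> \<Phi> y\<^sub>0 \<longrightarrow> blinfun_apply (A y\<^sub>0 - f\<^sub>0) (y\<^sub>0 - v) \<le> 0)"
proof -
  obtain C where C: "C > 0" "\<And>u v. A u v \<le> C * norm u * norm v"
    using assms(3) unfolding admissible_operator_def by blast
  obtain c where coer: "c > 0" "\<And>u. c * (norm u)\<^sup>2 \<le> A u u"
    using assms(3) unfolding admissible_operator_def by blast
  have AC: "norm (A u) \<le> norm u * C" for u
  proof (rule norm_blinfun_bound)
    show "norm (A u v) \<le> norm u * C * norm v" for v
      using C(2)[of u v] C(2)[of u "- v"] by (simp add: blinfun.minus_right abs_le_iff mult_ac)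
  qed (use C(1) in simp)
  have A: "bounded_linear A"
  proof (rule bounded_linear.intro)
    show "linear A" using assms(3) by (simp add: admissible_operator_def)
    show "bounded_linear_axioms A" using AC by (intro bounded_linear_axioms.intro) blast
  qed
  obtain v\<^sub>0 where v\<^sub>0: "\<And>v. v\<^sub>0 \<le> \<Phi> v" using assms(5) by blast
  \<comment> \<open>Here \<open>y - v\<^sub>0\<close> is \<open>y - \<Phi> y\<close> plus the
    nonnegative element \<open>\<Phi> y - v\<^sub>0\<close>.\<close>
  have pen: "0 \<le> m \<rho> (y - \<Phi> y) (y - v\<^sub>0)" if "\<rho> > 0" for \<rho> y
    using penalty_nonneg[of "m \<rho>" "\<Phi> y - v\<^sub>0" "y - \<Phi> y"] assms(4) that v\<^sub>0
    by (simp add: penalty_maps_def)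
  have solvable: "\<exists>y. A y + (1 / \<rho>) *\<^sub>R m \<rho> (y - \<Phi> y) = f \<rho>" if \<rho>: "\<rho> > 0" for \<rho>
    using assms(6)
  proof (elim disjE)
    assume "\<forall>\<rho>>0. completely_continuous (\<lambda>v. m \<rho> (v - \<Phi> v))"
    then have "completely_continuous (\<lambda>v. (1 / \<rho>) *\<^sub>R m \<rho> (v - \<Phi> v))"
      using \<rho> by (simp add: completely_continuous_def tendsto_scaleR)
    then show ?thesis
      using \<rho> pen by (intro solvable_completely_continuous[OF assms(1) A coer, where v = v\<^sub>0])
        (simp_all add: blinfun.scaleR_left)
  next
    assume "\<forall>\<rho>>0. monotone_operator (\<lambda>v. m \<rho> (v - \<Phi> v)) \<and>
      radially_continuous (\<lambda>v. m \<rho> (v - \<Phi> v)) \<and> bounded_operator (\<lambda>v. m \<rho> (v - \<Phi> v))"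
    then have "monotone_operator (\<lambda>v. (1 / \<rho>) *\<^sub>R m \<rho> (v - \<Phi> v))"
      "radially_continuous (\<lambda>v. (1 / \<rho>) *\<^sub>R m \<rho> (v - \<Phi> v))"
      using \<rho> by (simp_all add: monotone_operator_def radially_continuous_def blinfun.scaleR_left
          continuous_on_divide flip: scaleR_diff_right)
    then show ?thesis
      by (rule browder_minty[OF assms(1) A coer])
  qed
  \<comment> \<open>Any positive null sequence would do; the required parameters are its subsequence
    along \<open>h\<close>.\<close>
  define \<rho> where "\<rho> = (\<lambda>n. inverse (real (Suc n)))"
  have \<rho>: "\<rho> n > 0" for n by (simp add: \<rho>_def)
  have \<rho>0: "\<rho> \<longlonglongrightarrow> 0"
    unfolding \<rho>_def by (rule LIMSEQ_inverse_real_of_nat)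
  then have "filterlim \<rho> (at_right 0) sequentially"
    using \<rho> by (intro tendsto_imp_filterlim_at_right) (simp_all add: always_eventually)
  then have f: "(\<lambda>n. f (\<rho> n)) \<longlonglongrightarrow> f\<^sub>0"
    using assms(8) by (rule filterlim_compose[rotated])
  obtain b where b: "\<And>n. norm (f (\<rho> n)) \<le> b"
    using convergent_imp_Bseq[of "\<lambda>n. f (\<rho> n)"] f by (auto simp: convergent_def Bseq_def)
  have "\<exists>y. \<forall>n. A (y n) + (1 / \<rho> n) *\<^sub>R m (\<rho> n) (y n - \<Phi> (y n)) = f (\<rho> n)"
    by (intro choice allI solvable \<rho>)
  then obtain y where y: "\<And>n. A (y n) + (1 / \<rho> n) *\<^sub>R m (\<rho> n) (y n - \<Phi> (y n)) = f (\<rho> n)"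
    by blast
  have bd: "norm (y n) \<le> 1 + (b + C * norm v\<^sub>0 + b * norm v\<^sub>0) / c" for n
    using \<rho>[of n] pen by (intro a_priori_bound[OF AC coer y _ b]) (simp add: blinfun.scaleR_left)
  obtain h y\<^sub>0 where h: "strict_mono h" and y\<^sub>0: "weakly_converges (\<lambda>n. y (h n)) y\<^sub>0"
    using coercive_weakly_sequentially_compact[where x = y, OF assms(1) A coer bd] by blast
  have lim: "(\<lambda>n. \<rho> (h n)) \<longlonglongrightarrow> 0" "(\<lambda>n. f (\<rho> (h n))) \<longlonglongrightarrow> f\<^sub>0"
    using LIMSEQ_subseq_LIMSEQ[OF \<rho>0 h] LIMSEQ_subseq_LIMSEQ[OF f h] by (simp_all add: o_def)
  have "(\<lambda>n. y (h n)) \<longlonglongrightarrow> y\<^sub>0 \<and> y\<^sub>0 \<le> \<Phi> y\<^sub>0 \<and>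
      (\<forall>v. v \<le> \<Phi> y\<^sub>0 \<longrightarrow> (A y\<^sub>0 - f\<^sub>0) (y\<^sub>0 - v) \<le> 0)"
    by (rule penalty_limit[where r = "\<lambda>n. \<rho> (h n)" and g = "\<lambda>n. f (\<rho> (h n))", OF A coer assms(4,7)])
      (rule \<rho> lim y y\<^sub>0 bd)+
  with \<rho> lim(1) y show ?thesis
    by (intro exI[of _ "\<lambda>n. \<rho> (h n)"] exI[of _ "\<lambda>n. y (h n)"] exI[of _ y\<^sub>0]) blast
qed

end
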